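(* Let $\alpha>0$ and let $k$ be a kernel (symmetric, integrable, non-trivial, nonnegative, $k(0)=0$) with finite $\alpha$-th moment, i.e. $\sum_{j\in\mathbb{Z}}k(j)|j|^\alpha<\infty$. Let $L$ be the operator generated by $k$. Suppose that $L$ satisfies $CD_\Upsilon(0,F)$ with a $CD$-function $F$ such that the function $g:[0,\infty)\to[0,\infty)$, $g(x)=\frac{F(x)}{x}$ for $x>0$, $g(0)=0$, satisfies $$g(x)+g(y)\le g(x+y),\qquad x,y\in[0,\infty).$$ Let $\varphi$ be the relaxation function associated with the function $2F$. Let $u:[0,\infty)\times\mathbb{Z}\to(0,\infty)$ be a bounded function that is $C^1$ in time and solves $$\partial_tu(t,x)-Lu(t,x)=0\quad\text{on }(0,\infty)\times\mathbb{Z}.$$ Then for $v(t,x)=\log u(t,x)$ one has $v(t,x+\cdot)\in\ell_k^1(\mathbb{Z})$ for every $(t,x)\in(0,\infty)\times\mathbb{Z}$, and $$-Lv(t,x)\le\varphi(t),\qquad (t,x)\in(0,\infty)\times\mathbb{Z},$$ and thus $$\partial_tv(t,x)\ge\Psi_\Upsilon(v)(t,x)-\varphi(t),\qquad (t,x)\in(0,\infty)\times\mathbb{Z}.$$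
   Context: Kernel and operator: $k:\mathbb{Z}\to[0,\infty)$ is not identically zero, $k(0)=0$, $k(j)=k(-j)$ for all $j$, and $|k|_1:=\sum_{j\in\mathbb{Z}}k(j)<\infty$. The operator generated by $k$ is $Lu(x)=\sum_{j\in\mathbb{Z}}k(j)\big(u(x+j)-u(x)\big)$, $x\in\mathbb{Z}$ (acting on the spatial variable for functions of $(t,x)$). $\ell^\infty(\mathbb{Z})$ denotes the bounded functions $\mathbb{Z}\to\mathbb{R}$, and $\ell^1_k(\mathbb{Z})=\{w:\mathbb{Z}\to\mathbb{R}:\sum_{j\in\mathbb{Z}}k(j)|w(j)|<\infty\}$; $Lw(x)$ is well defined when $w(x+\cdot)\in\ell^1_k(\mathbb{Z})$. Let $\Upsilon(r)=e^r-1-r$, $r\in\mathbb{R}$. Put $\Psi_\Upsilon(u)(x)=\sum_{y\in\mathbb{Z}}k(x-y)\Upsilon(u(y)-u(x))$, and for $u,v\in\ell^\infty(\mathbb{Z})$ put $B_{\Upsilon'}(u,v)(x)=\sum_{y\in\mathbb{Z}}k(x-y)\Upsilon'(u(y)-u(x))(v(y)-v(x))$ and $\Psi_{2,\Upsilon}(u)(x)=\frac12\big(L\Psi_\Upsilon(u)(x)-B_{\Upsilon'}(u,Lu)(x)\big)$. A $CD$-function is a continuous $F:[0,\infty)\to[0,\infty)$ with $F(0)=0$, $r\mapsto F(r)/r$ strictly increasing on $(0,\infty)$, and $1/F$ integrable at $\infty$. The relaxation function of a $CD$-function $F$ is the unique strictly positive solution $\varphi:(0,\infty)\to(0,\infty)$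 of $\dot\varphi(t)=-F(\varphi(t))$, $t>0$, with $\varphi(0+)=\infty$. $L$ satisfies $CD_\Upsilon(0,F)$ if for every $u\in\ell^\infty(\mathbb{Z})$ and every $x\in\mathbb{Z}$: $\Psi_{2,\Upsilon}(u)(x)\ge F(-Lu(x))$ whenever $-Lu(x)\ge 0$ (and $\Psi_{2,\Upsilon}(u)(x)\ge 0$ otherwise). *)

theory Defs
  imports "HOL-Analysis.Analysis"
begin

text \<open>
  All sums over the integers are unordered sums (\<^const>\<open>infsum\<close>, \<^const>\<open>summable_on\<close>); for
  real-valued families this is absolute convergence.  A non-summable family has \<^const>\<open>infsum\<close>
  equal to 0, so the operators below are meaningful only where the defining family is summable.
\<close>

definition jump_kernel :: "(int \<Rightarrow> real) \<Rightarrow> bool" where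
  "jump_kernel k \<longleftrightarrow>
     (\<forall>j. 0 \<le> k j) \<and> (\<exists>j. k j \<noteq> 0) \<and> k 0 = 0 \<and> (\<forall>j. k j = k (- j)) \<and> k summable_on UNIV"

definition nonlocal_op :: "(int \<Rightarrow> real) \<Rightarrow> (int \<Rightarrow> real) \<Rightarrow> int \<Rightarrow> real" where
  "nonlocal_op k u x = (\<Sum>\<^sub>\<infinity>j. k j * (u (x + j) - u x))"

definition linfty :: "(int \<Rightarrow> real) set" where
  "linfty = {u. bounded (range u)}"

definition l1k :: "(int \<Rightarrow> real) \<Rightarrow> (int \<Rightarrow> real) set" where
  "l1k k = {w. (\<lambda>j. k j * \<bar>w j\<bar>) summable_on UNIV}"

definition Upsilon :: "real \<Rightarrow> real" where
  "Upsilon r = exp r - 1 - r"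

definition Psi :: "(int \<Rightarrow> real) \<Rightarrow> (real \<Rightarrow> real) \<Rightarrow> (int \<Rightarrow> real) \<Rightarrow> int \<Rightarrow> real" where
  "Psi k H u x = (\<Sum>\<^sub>\<infinity>y. k (x - y) * H (u y - u x))"

definition B_op ::
  "(int \<Rightarrow> real) \<Rightarrow> (real \<Rightarrow> real) \<Rightarrow> (int \<Rightarrow> real) \<Rightarrow> (int \<Rightarrow> real) \<Rightarrow> int \<Rightarrow> real" where
  "B_op k H u v x = (\<Sum>\<^sub>\<infinity>y. k (x - y) * H (u y - u x) * (v y - v x))"

definition Psi2_Upsilon :: "(int \<Rightarrow> real) \<Rightarrow> (int \<Rightarrow> real) \<Rightarrow> int \<Rightarrow> real" where
  "Psi2_Upsilon k u x =
     1 / 2 * (nonlocal_op k (Psi k Upsilon u) x - B_op k (deriv Upsilon) u (nonlocal_op k u) x)"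

lemma deriv_Upsilon: "deriv Upsilon = (\<lambda>r. exp r - 1)"
proof
  fix r :: real
  have "(Upsilon has_real_derivative exp r - 1) (at r)"
    unfolding Upsilon_def by (auto intro!: derivative_eq_intros)
  then show "deriv Upsilon r = exp r - 1"
    by (rule DERIV_imp_deriv)
qed

text \<open>Functions on the half-line are total functions whose values at negative arguments are
  irrelevant.\<close>

definition CD_function :: "(real \<Rightarrow> real) \<Rightarrow> bool" where
  "CD_function F \<longleftrightarrow>
     continuous_on {0..} F \<and> (\<forall>r\<ge>0. 0 \<le> F r) \<and> F 0 = 0 \<and>
     strict_mono_on {0<..} (\<lambda>r. F r / r) \<and>
     (\<exists>R>0. set_integrable lborel {R..} (\<lambda>r. 1 / F r))"

text \<open>For a CD-function \<open>F\<close> there is exactly one such \<open>\<phi>\<close> on the positive half-line, so the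
  predicate determines the relaxation function.\<close>

definition relaxation_function :: "(real \<Rightarrow> real) \<Rightarrow> (real \<Rightarrow> real) \<Rightarrow> bool" where
  "relaxation_function F \<phi> \<longleftrightarrow>
     (\<forall>t>0. 0 < \<phi> t \<and> (\<phi> has_real_derivative - F (\<phi> t)) (at t)) \<and>
     filterlim \<phi> at_top (at_right 0)"

definition CD_Upsilon_0 :: "(int \<Rightarrow> real) \<Rightarrow> (real \<Rightarrow> real) \<Rightarrow> bool" where
  "CD_Upsilon_0 k F \<longleftrightarrow>
     (\<forall>u\<in>linfty. \<forall>x.
        (if 0 \<le> - nonlocal_op k u x
         then F (- nonlocal_op k u x) \<le> Psi2_Upsilon k u x
         else 0 \<le> Psi2_Upsilon k u x))"

text \<open>Continuous differentiability on the closed half-line, one-sided at 0.\<close>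

definition C1_halfline :: "(real \<Rightarrow> real) \<Rightarrow> bool" where
  "C1_halfline f \<longleftrightarrow>
     (\<exists>f'. (\<forall>t\<ge>0. (f has_real_derivative f' t) (at t within {0..})) \<and> continuous_on {0..} f')"

end

theory Submission
  imports Defs
begin

text \<open>
  The logarithm \<open>w\<close> of a positive solution of \<open>\<partial>\<^sub>t u = L u\<close> satisfies \<open>\<partial>\<^sub>t w = L w + \<Psi>\<^sub>\<Upsilon>(w)\<close>
  (\<open>ln_heat_solution_derivative\<close>), so the last claim of the theorem is the estimate \<open>- L w \<le> \<phi>\<close>
  read through this equation.

  Suppose first that \<open>u\<close> is bounded away from zero, so that \<open>w\<close> is bounded and the curvature
  condition applies to it.  Since the kernel is summable, \<open>G = - L w\<close> is bounded and may be
  differentiated in time under the sum.  Writing \<open>A\<close> for the jump operator with the rates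
  \<open>k j * exp (w (x + j) - w x)\<close>, the chain rule \<open>nonlocal_op_chain_rule\<close> gives
  \<open>\<partial>\<^sub>t G = A G - 2 \<Psi>\<^sub>2(w)\<close>, and hence \<open>\<partial>\<^sub>t G \<le> A G - 2 F(G)\<close> where \<open>G\<close> is positive.  The
  spatially constant function \<open>\<phi>\<close> solves \<open>\<partial>\<^sub>t \<phi> = - 2 F(\<phi>)\<close> and is infinite at time zero, so it
  starts above \<open>G\<close>; as \<open>F\<close> is increasing, it can only be overtaken if the maximum principle for
  \<open>A\<close> fails.  The rates of \<open>A\<close> have bounded total mass because \<open>w\<close> is bounded, and for
  such operators bounded functions obey a maximum principle even if their suprema over the infinite
  state space are not attained (\<open>maximum_principle_bounded_rates\<close>).

  In general \<open>u + \<epsilon>\<close> is again a solution, because \<open>L\<close> annihilates constants.  The estimate for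
  \<open>ln (u + \<epsilon>)\<close> is uniform in \<open>\<epsilon>\<close>, and \<open>ln (u + \<epsilon>)\<close> converges to \<open>ln u\<close> and is bounded above.  A limit
  in the manner of Fatou therefore yields both the summability of \<open>k j * ln (u (x + j))\<close> and the estimate for \<open>ln u\<close>
  (\<open>nonlocal_op_ln_shift_limit\<close>).
\<close>

section \<open>Infinite sums: differences and derivatives\<close>

lemma
  fixes f g :: "'a \<Rightarrow> 'b::{real_normed_vector}"
  assumes "f summable_on A" and "g summable_on A"
  shows summable_on_diff: "(\<lambda>x. f x - g x) summable_on A"
    and infsum_diff: "infsum (\<lambda>x. f x - g x) A = infsum f A - infsum g A"
proof -
  have "((\<lambda>x. f x + - g x) has_sum (infsum f A + - infsum g A)) A"
    using assms by (intro has_sum_add has_sum_infsum) (auto simp: has_sum_uminus)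
  then show "(\<lambda>x. f x - g x) summable_on A" "infsum (\<lambda>x. f x - g x) A = infsum f A - infsum g A"
    by (auto simp: infsumI summable_on_def)
qed

text \<open>The difference quotients are dominated by the same \<open>b\<close> as the derivatives, by the mean value
  theorem, so by the Weierstrass test they sum uniformly and the two limits may be exchanged.\<close>

lemma has_real_derivative_infsum:
  fixes f f' :: "'a \<Rightarrow> real \<Rightarrow> real"
  assumes S: "open S" "convex S" "t \<in> S"
    and deriv: "\<And>j s. s \<in> S \<Longrightarrow> (f j has_real_derivative f' j s) (at s)"
    and bound: "\<And>j s. s \<in> S \<Longrightarrow> \<bar>f' j s\<bar> \<le> b j"
    and b: "b summable_on UNIV"
    and f: "\<And>s. s \<in> S \<Longrightarrow> (\<lambda>j. f j s) summable_on UNIV"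
  shows "((\<lambda>s. \<Sum>\<^sub>\<infinity>j. f j s) has_real_derivative (\<Sum>\<^sub>\<infinity>j. f' j t)) (at t)"
proof -
  define q where "q j s = (f j s - f j t) / (s - t)" for j s
  have q_bound: "\<bar>q j s\<bar> \<le> b j" if s: "s \<in> S" for j s
  proof (cases "s = t")
    case True
    then show ?thesis
      using bound[OF S(3), of j] by (simp add: q_def)
  next
    case False
    have "norm (f j s - f j t) \<le> b j * norm (s - t)"
      using S s deriv bound
      by (intro field_differentiable_bound[of S "f j" "f' j"])
        (auto intro: has_field_derivative_at_within)
    then show ?thesis
      using False by (simp add: q_def divide_simps)
  qed
  have "uniform_limit S (\<lambda>A s. \<Sum>j\<in>A. q j s) (\<lambda>s. \<Sum>\<^sub>\<infinity>j. q j s) (finite_subsets_at_top UNIV)"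
    using q_bound b by (intro Weierstrass_m_test_general) auto
  moreover have "((\<lambda>s. \<Sum>j\<in>A. q j s) \<longlongrightarrow> (\<Sum>j\<in>A. f' j t)) (at t within S)" for A
  proof (rule tendsto_sum)
    show "(q j \<longlongrightarrow> f' j t) (at t within S)" for j
      using has_field_derivative_at_within[OF deriv[OF S(3)], of j S]
      by (simp add: q_def[abs_def] has_field_derivative_iff)
  qed
  moreover have "(\<lambda>j. norm (f' j t)) summable_on UNIV"
    using bound[OF S(3)] by (intro Infinite_Sum.abs_summable_on_comparison_test'[OF b]) auto
  then have "((\<lambda>A. \<Sum>j\<in>A. f' j t) \<longlongrightarrow> (\<Sum>\<^sub>\<infinity>j. f' j t)) (finite_subsets_at_top UNIV)"
    by (rule infsum_tendsto[OF Infinite_Sum.abs_summable_summable])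
  ultimately have "((\<lambda>s. \<Sum>\<^sub>\<infinity>j. q j s) \<longlongrightarrow> (\<Sum>\<^sub>\<infinity>j. f' j t)) (at t within S)"
    by (intro swap_uniform_limit[where F = "finite_subsets_at_top UNIV"]) (auto intro: always_eventually)
  moreover have "(\<Sum>\<^sub>\<infinity>j. q j s) = ((\<Sum>\<^sub>\<infinity>j. f j s) - (\<Sum>\<^sub>\<infinity>j. f j t)) / (s - t)" if "s \<in> S" for s
    using infsum_diff[OF f[OF that] f[OF S(3)]]
      infsum_cmult_left'[of "\<lambda>j. f j s - f j t" "1 / (s - t)" UNIV]
    by (simp add: q_def)
  ultimately have "((\<lambda>s. ((\<Sum>\<^sub>\<infinity>j. f j s) - (\<Sum>\<^sub>\<infinity>j. f j t)) / (s - t)) \<longlongrightarrow> (\<Sum>\<^sub>\<infinity>j. f' j t)) (at t within S)"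
    by (elim Lim_transform_eventually) (auto simp: eventually_at_filter)
  then have "((\<lambda>s. \<Sum>\<^sub>\<infinity>j. f j s) has_real_derivative (\<Sum>\<^sub>\<infinity>j. f' j t)) (at t within S)"
    by (simp add: has_field_derivative_iff)
  then show ?thesis
    by (simp only: at_within_open[OF S(3,1)])
qed

section \<open>A maximum principle\<close>

text \<open>The mean value theorem after the last time at which \<open>f \<le> c\<close>.\<close>

lemma upcrossing_positive_derivative:
  fixes f f' :: "real \<Rightarrow> real"
  assumes "a \<le> b" "f a \<le> c" "c < f b"
    and deriv: "\<And>s. \<lbrakk>a \<le> s; s \<le> b\<rbrakk> \<Longrightarrow> (f has_real_derivative f' s) (at s)"
  obtains s where "a < s" "s \<le> b" "c < f s" "0 < f' s"
proof -
  define Z where "Z = {s \<in> {a..b}. f s \<le> c}"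
  have cont: "continuous_on {a..b} f"
    using deriv by (intro continuous_at_imp_continuous_on ballI DERIV_isCont) auto
  have "compact Z"
    unfolding Z_def compact_eq_bounded_closed
    using continuous_closed_preimage[OF cont, of "{..c}"]
    by (auto simp: vimage_def Int_def intro: bounded_subset[of "{a..b}"])
  moreover have "a \<in> Z"
    using assms by (auto simp: Z_def)
  ultimately obtain r where r: "r \<in> Z" "\<And>s. s \<in> Z \<Longrightarrow> s \<le> r"
    using compact_attains_sup[of Z] by auto
  have "r < b"
    using r(1) assms(3) by (cases "r = b") (auto simp: Z_def)
  moreover have "(f has_real_derivative f' s) (at s)" if "r \<le> s" "s \<le> b" for s
    using that r(1) by (intro deriv) (auto simp: Z_def)
  ultimately obtain s where s: "r < s" "s < b" "f b - f r = (b - r) * f' s"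
    using MVT2[of r b f f'] by auto
  have "0 < (b - r) * f' s"
    using s(3) r(1) assms(3) by (auto simp: Z_def)
  then have "0 < f' s"
    using \<open>r < b\<close> by (simp add: zero_less_mult_iff)
  moreover have "c < f s"
    using r(1) r(2)[of s] s(1,2) by (fastforce simp: Z_def)
  ultimately show ?thesis
    using that[of s] s(1,2) r(1) by (auto simp: Z_def)
qed

text \<open>The growth condition bounds the time derivative of \<open>H\<close> by what a jump process with total rate
  at most \<open>K\<close> can produce.  On an infinite state space the supremum of \<open>H\<close> need not be attained; the
  weight \<open>exp (- t)\<close> supplies the strict contraction \<open>K / (K + 1) < 1\<close> that replaces the evaluation
  at a maximum point.\<close>

lemma maximum_principle_bounded_rates:
  fixes H D :: "real \<Rightarrow> 'a \<Rightarrow> real"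
  assumes "0 \<le> K"
    and bounded: "\<And>t x. a \<le> t \<Longrightarrow> H t x \<le> C"
    and initial: "\<And>x. H a x \<le> 0"
    and deriv: "\<And>t x. a \<le> t \<Longrightarrow> ((\<lambda>s. H s x) has_real_derivative D t x) (at t)"
    and growth: "\<And>t x m. \<lbrakk>a \<le> t; 0 < H t x; \<And>y. H t y \<le> m\<rbrakk> \<Longrightarrow> D t x \<le> K * (m - H t x)"
    and "a \<le> t"
  shows "H t x \<le> 0"
proof (rule ccontr)
  assume pos: "\<not> H t x \<le> 0"
  define h where "h s y = exp (- s) * H s y" for s y
  define X where "X = (\<lambda>(s, y). h s y) ` ({a..} \<times> UNIV)"
  have "h s y \<le> exp (- a) * \<bar>C\<bar>" if "a \<le> s" for s y
  proof -
    have "h s y \<le> exp (- s) * \<bar>C\<bar>"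
      using bounded[OF that, of y] by (auto simp: h_def)
    also have "\<dots> \<le> exp (- a) * \<bar>C\<bar>"
      using that by (intro mult_right_mono) auto
    finally show ?thesis .
  qed
  then have bdd: "bdd_above X"
    unfolding X_def by (intro bdd_aboveI) auto
  have h_le: "h s y \<le> Sup X" if "a \<le> s" for s y
    using that by (intro cSup_upper bdd) (force simp: X_def)
  have "0 < h t x"
    using pos by (simp add: h_def)
  then have S_pos: "0 < Sup X"
    using h_le[OF \<open>a \<le> t\<close>, of x] by linarith
  define c where "c = K * Sup X / (K + 1)"
  have "c \<ge> 0"
    using S_pos \<open>0 \<le> K\<close> by (simp add: c_def)
  have "h s y \<le> c" if "a \<le> s" for s y
  proof (rule ccontr)
    assume "\<not> h s y \<le> c"
    \<comment> \<open>Above the level \<open>c\<close> the function \<open>h\<close> decreases, since \<open>h' \<le> K Sup X - (K + 1) h < 0\<close> there.\<close>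
    moreover have "h a y \<le> c"
      using initial[of y] \<open>c \<ge> 0\<close> by (smt (verit) exp_gt_zero h_def mult_nonneg_nonpos)
    moreover have "((\<lambda>s. h s y) has_real_derivative exp (- r) * (D r y - H r y)) (at r)" if "a \<le> r" for r
      unfolding h_def using deriv[OF that]
      by (auto intro!: derivative_eq_intros simp: algebra_simps)
    ultimately obtain r where r: "a < r" "c < h r y" "0 < exp (- r) * (D r y - H r y)"
      using upcrossing_positive_derivative[OF \<open>a \<le> s\<close>, of "\<lambda>s. h s y" c "\<lambda>r. exp (- r) * (D r y - H r y)"]
      by auto
    have H_le: "H r z \<le> exp r * Sup X" for z
      using h_le[of r z] r(1) by (simp add: h_def exp_minus field_simps)
    have "0 < H r y"
      using order.strict_trans1[OF \<open>c \<ge> 0\<close> r(2)] by (simp add: h_def zero_less_mult_iff)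
    then have "D r y \<le> K * (exp r * Sup X - H r y)"
      using r(1) H_le by (intro growth) auto
    then have "exp (- r) * (D r y - H r y) \<le> exp (- r) * (K * (exp r * Sup X - H r y) - H r y)"
      by simp
    also have "\<dots> = K * Sup X - (K + 1) * h r y"
      by (simp add: h_def exp_minus field_simps)
    also have "\<dots> < 0"
      using r(2) \<open>0 \<le> K\<close> by (simp add: c_def field_simps)
    finally show False
      using r(3) by simp
  qed
  then have "Sup X \<le> c"
    by (intro cSup_least) (auto simp: X_def)
  then show False
    using S_pos \<open>0 \<le> K\<close> by (simp add: c_def field_simps)
qed

section \<open>Calculus of the jump operator\<close>

lemma jump_kernel_summable_mult:
  assumes "jump_kernel k" and "\<And>j. \<bar>w j\<bar> \<le> C"
  shows "(\<lambda>j. k j * w j) summable_on UNIV"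
proof -
  have "(\<lambda>j. k j * C) summable_on UNIV"
    using assms(1) by (auto simp: jump_kernel_def intro: summable_on_cmult_left)
  then have "(\<lambda>j. norm (k j * w j)) summable_on UNIV"
    by (rule Infinite_Sum.abs_summable_on_comparison_test')
      (use assms in \<open>auto simp: jump_kernel_def abs_mult intro!: mult_left_mono\<close>)
  then show ?thesis
    by (rule abs_summable_summable)
qed

lemma jump_kernel_infsum_bound:
  assumes "jump_kernel k" and "\<And>j. \<bar>w j\<bar> \<le> C"
  shows "\<bar>\<Sum>\<^sub>\<infinity>j. k j * w j\<bar> \<le> infsum k UNIV * C"
proof -
  have "((\<lambda>j. k j * C) has_sum (infsum k UNIV * C)) UNIV"
    using assms(1) by (auto simp: jump_kernel_def intro: has_sum_cmult_left)
  with has_sum_infsum[OF jump_kernel_summable_mult[OF assms]]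
  have "norm (\<Sum>\<^sub>\<infinity>j. k j * w j) \<le> infsum k UNIV * C"
    by (rule norm_infsum_le)
      (use assms in \<open>auto simp: jump_kernel_def abs_mult intro!: mult_left_mono\<close>)
  then show ?thesis
    by simp
qed

lemma bij_betw_translate: "bij_betw (\<lambda>j. x + j) UNIV (UNIV :: int set)"
  by (rule bij_betwI[of _ _ _ "\<lambda>y. y - x"]) auto

lemma jump_kernel_reflect_translate: "jump_kernel k \<Longrightarrow> k (x - (x + j)) = k j"
  by (simp add: jump_kernel_def)

lemma Psi_increments:
  assumes "jump_kernel k"
  shows "Psi k H w x = (\<Sum>\<^sub>\<infinity>j. k j * H (w (x + j) - w x))"
  unfolding Psi_def
  by (subst infsum_reindex_bij_betw[OF bij_betw_translate[of x], symmetric])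
    (simp only: jump_kernel_reflect_translate[OF assms])

lemma Psi_summable_increments:
  assumes "jump_kernel k"
  shows "(\<lambda>y. k (x - y) * H (w y - w x)) summable_on UNIV \<longleftrightarrow>
    (\<lambda>j. k j * H (w (x + j) - w x)) summable_on UNIV"
  by (subst summable_on_reindex_bij_betw[OF bij_betw_translate[of x], symmetric])
    (simp only: jump_kernel_reflect_translate[OF assms])

lemma B_op_increments:
  assumes "jump_kernel k"
  shows "B_op k H w z x = (\<Sum>\<^sub>\<infinity>j. k j * H (w (x + j) - w x) * (z (x + j) - z x))"
  unfolding B_op_def
  by (subst infsum_reindex_bij_betw[OF bij_betw_translate[of x], symmetric])
    (simp only: jump_kernel_reflect_translate[OF assms])

text \<open>Chain rule for the exponential: the logarithm \<open>w\<close> of a solution of the heat equation satisfies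
  \<open>\<partial>\<^sub>t w = L w + \<Psi>\<^sub>\<Upsilon>(w)\<close>, the right-hand side here being \<open>L (exp w) / exp w\<close>.\<close>

lemma nonlocal_op_plus_Psi:
  assumes "jump_kernel k"
    and w: "(\<lambda>j. k j * (w (x + j) - w x)) summable_on UNIV"
    and e: "(\<lambda>j. k j * (exp (w (x + j) - w x) - 1)) summable_on UNIV"
  shows "(\<lambda>j. k j * Upsilon (w (x + j) - w x)) summable_on UNIV"
    and "nonlocal_op k w x + Psi k Upsilon w x = (\<Sum>\<^sub>\<infinity>j. k j * (exp (w (x + j) - w x) - 1))"
proof -
  have eq: "(\<lambda>j. k j * Upsilon (w (x + j) - w x)) =
      (\<lambda>j. k j * (exp (w (x + j) - w x) - 1) - k j * (w (x + j) - w x))"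
    by (auto simp: Upsilon_def algebra_simps)
  show "(\<lambda>j. k j * Upsilon (w (x + j) - w x)) summable_on UNIV"
    unfolding eq by (intro summable_on_diff e w)
  show "nonlocal_op k w x + Psi k Upsilon w x = (\<Sum>\<^sub>\<infinity>j. k j * (exp (w (x + j) - w x) - 1))"
    unfolding Psi_increments[OF assms(1)] eq
    by (simp add: infsum_diff[OF e w] nonlocal_op_def)
qed

lemma exp_increment_bounds:
  fixes w :: "'a \<Rightarrow> real"
  assumes "\<And>y. \<bar>w y\<bar> \<le> C"
  shows "\<bar>w y - w x\<bar> \<le> 2 * C" "exp (w y - w x) \<le> exp (2 * C)" "\<bar>exp (w y - w x) - 1\<bar> \<le> exp (2 * C)"
proof -
  show "\<bar>w y - w x\<bar> \<le> 2 * C"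
    using assms[of x] assms[of y] by linarith
  then show e: "exp (w y - w x) \<le> exp (2 * C)"
    by simp
  have "0 \<le> C"
    using assms[of x] by linarith
  then have "1 \<le> exp (2 * C)"
    by simp
  then show "\<bar>exp (w y - w x) - 1\<bar> \<le> exp (2 * C)"
    using e exp_gt_zero[of "w y - w x"] unfolding abs_le_iff by linarith
qed

text \<open>Since \<open>\<Upsilon>' r = exp r - 1\<close>, the term \<open>B\<^sub>\<Upsilon>'(w, L w)\<close> in the definition of \<open>\<Psi>\<^sub>2\<close> turns the generator
  acting on \<open>L w\<close> into the jump operator with rates \<open>k j * exp (w (x + j) - w x)\<close>, whose
  rates are again nonnegative, as the maximum principle requires.\<close>

lemma nonlocal_op_chain_rule:
  assumes k: "jump_kernel k" and w: "\<And>y. \<bar>w y\<bar> \<le> C"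
  shows "(\<lambda>j. k j * exp (w (x + j) - w x) * (nonlocal_op k w (x + j) - nonlocal_op k w x)) summable_on UNIV"
    and "nonlocal_op k (\<lambda>y. nonlocal_op k w y + Psi k Upsilon w y) x =
      (\<Sum>\<^sub>\<infinity>j. k j * exp (w (x + j) - w x) * (nonlocal_op k w (x + j) - nonlocal_op k w x))
        + 2 * Psi2_Upsilon k w x"
proof -
  note bounds = exp_increment_bounds[of w C, OF w]
  define l where "l = nonlocal_op k w"
  define p where "p = Psi k Upsilon w"
  define E where "E j = exp (w (x + j) - w x)" for j
  have "\<bar>l y\<bar> \<le> infsum k UNIV * (2 * C)" for y
    unfolding l_def nonlocal_op_def by (intro jump_kernel_infsum_bound k bounds)
  then have dl: "\<bar>l y - l x\<bar> \<le> 2 * (infsum k UNIV * (2 * C))" for y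
    by (rule exp_increment_bounds(1)[of l])
  have "\<bar>Upsilon (w z - w y)\<bar> \<le> exp (2 * C) + 2 * C" for y z
    using bounds(1,3)[of z y] unfolding Upsilon_def by linarith
  then have "\<bar>p y\<bar> \<le> infsum k UNIV * (exp (2 * C) + 2 * C)" for y
    unfolding p_def Psi_increments[OF k] by (intro jump_kernel_infsum_bound k)
  then have dp: "\<bar>p y - p x\<bar> \<le> 2 * (infsum k UNIV * (exp (2 * C) + 2 * C))" for y
    by (rule exp_increment_bounds(1)[of p])
  have l: "(\<lambda>j. k j * (l (x + j) - l x)) summable_on UNIV"
    by (rule jump_kernel_summable_mult[OF k dl])
  have p: "(\<lambda>j. k j * (p (x + j) - p x)) summable_on UNIV"
    by (rule jump_kernel_summable_mult[OF k dp])
  have El: "(\<lambda>j. k j * (E j * (l (x + j) - l x))) summable_on UNIV"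
  proof (rule jump_kernel_summable_mult[OF k])
    show "\<bar>E j * (l (x + j) - l x)\<bar> \<le> exp (2 * C) * (2 * (infsum k UNIV * (2 * C)))" for j
      unfolding abs_mult using bounds(2) dl by (intro mult_mono) (auto simp: E_def)
  qed
  then show "(\<lambda>j. k j * exp (w (x + j) - w x) * (nonlocal_op k w (x + j) - nonlocal_op k w x)) summable_on UNIV"
    by (simp add: E_def l_def mult.assoc)
  have "B_op k (deriv Upsilon) w l x =
      (\<Sum>\<^sub>\<infinity>j. k j * (E j * (l (x + j) - l x)) - k j * (l (x + j) - l x))"
    unfolding B_op_increments[OF k] deriv_Upsilon E_def by (simp add: algebra_simps)
  also have "\<dots> = (\<Sum>\<^sub>\<infinity>j. k j * (E j * (l (x + j) - l x))) - nonlocal_op k l x"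
    by (simp add: infsum_diff[OF El l] nonlocal_op_def)
  finally have B: "B_op k (deriv Upsilon) w l x = \<dots>" .
  have "nonlocal_op k (\<lambda>y. l y + p y) x =
      (\<Sum>\<^sub>\<infinity>j. k j * (l (x + j) - l x) + k j * (p (x + j) - p x))"
    unfolding nonlocal_op_def by (simp add: algebra_simps)
  also have "\<dots> = nonlocal_op k l x + nonlocal_op k p x"
    by (simp add: infsum_add[OF l p] nonlocal_op_def)
  also have "\<dots> = (\<Sum>\<^sub>\<infinity>j. k j * (E j * (l (x + j) - l x))) + 2 * Psi2_Upsilon k w x"
    unfolding Psi2_Upsilon_def l_def[symmetric] p_def[symmetric] B by (simp add: field_simps)
  finally show "nonlocal_op k (\<lambda>y. nonlocal_op k w y + Psi k Upsilon w y) x =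
      (\<Sum>\<^sub>\<infinity>j. k j * exp (w (x + j) - w x) * (nonlocal_op k w (x + j) - nonlocal_op k w x))
        + 2 * Psi2_Upsilon k w x"
    by (simp add: E_def l_def p_def mult.assoc)
qed

lemma ln_heat_solution_derivative:
  assumes k: "jump_kernel k"
    and pos: "\<And>y. 0 < u t y"
    and le: "\<And>y. u t y \<le> M"
    and w: "\<And>y. w t y = ln (u t y)"
    and summable: "(\<lambda>j. k j * (w t (x + j) - w t x)) summable_on UNIV"
    and u: "((\<lambda>s. u s x) has_real_derivative nonlocal_op k (u t) x) (at t)"
  shows "(\<lambda>j. k j * Upsilon (w t (x + j) - w t x)) summable_on UNIV"
    and "((\<lambda>s. ln (u s x)) has_real_derivative nonlocal_op k (w t) x + Psi k Upsilon (w t) x) (at t)"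
proof -
  have e: "exp (w t (x + j) - w t x) - 1 = (u t (x + j) - u t x) / u t x" for j
    using pos[of x] pos[of "x + j"] by (simp add: w exp_diff field_simps)
  have "\<bar>u t y - u t x\<bar> \<le> M" for y
    using pos[of x] pos[of y] le[of x] le[of y] by linarith
  then have u_sum: "(\<lambda>j. k j * (u t (x + j) - u t x)) summable_on UNIV"
    by (rule jump_kernel_summable_mult[OF k])
  from summable_on_cmult_left[OF this, of "1 / u t x"]
  have e_sum: "(\<lambda>j. k j * (exp (w t (x + j) - w t x) - 1)) summable_on UNIV"
    by (simp add: e)
  show "(\<lambda>j. k j * Upsilon (w t (x + j) - w t x)) summable_on UNIV"
    by (rule nonlocal_op_plus_Psi(1)[OF k summable e_sum])
  have "nonlocal_op k (w t) x + Psi k Upsilon (w t) x = nonlocal_op k (u t) x / u t x"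
    unfolding nonlocal_op_plus_Psi(2)[OF k summable e_sum] e
    using infsum_cmult_left'[of "\<lambda>j. k j * (u t (x + j) - u t x)" "1 / u t x" UNIV]
    by (simp add: nonlocal_op_def)
  then show "((\<lambda>s. ln (u s x)) has_real_derivative nonlocal_op k (w t) x + Psi k Upsilon (w t) x) (at t)"
    using pos[of x] by (auto intro!: derivative_eq_intros u simp: divide_inverse mult.commute)
qed

section \<open>The estimate for solutions bounded away from zero\<close>

lemma CD_function_mono:
  assumes "CD_function F" "0 < x" "x < y"
  shows "F x \<le> F y"
proof -
  have "F x / x < F y / y"
    using assms by (auto simp: CD_function_def strict_mono_on_def)
  moreover have "0 \<le> F x / x"
    using assms by (auto simp: CD_function_def)
  ultimately have "x * (F x / x) \<le> y * (F y / y)"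
    using assms by (intro mult_mono) auto
  then show ?thesis
    using assms by simp
qed

text \<open>By the chain rule \<open>G = - L w\<close> is a subsolution of \<open>\<partial>\<^sub>t G = A G - 2 F(G)\<close> where it is
  positive, with \<open>A\<close> a jump operator of bounded total rate, and \<open>\<phi>\<close> is a spatially constant solution
  that exceeds the bounded function \<open>G\<close> at small times.\<close>

lemma neg_nonlocal_op_ln_le_relaxation:
  assumes k: "jump_kernel k" and F: "CD_function F" and CD: "CD_Upsilon_0 k F"
    and \<phi>: "relaxation_function (\<lambda>r. 2 * F r) \<phi>"
    and \<epsilon>: "0 < \<epsilon>" "\<And>t x. 0 < t \<Longrightarrow> \<epsilon> \<le> u t x"
    and M: "\<And>t x. 0 < t \<Longrightarrow> u t x \<le> M"
    and u: "\<And>t x. 0 < t \<Longrightarrow> ((\<lambda>s. u s x) has_real_derivative nonlocal_op k (u t) x) (at t)"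
    and t: "0 < t"
  shows "- nonlocal_op k (\<lambda>y. ln (u t y)) x \<le> \<phi> t"
proof -
  define w where "w s y = ln (u s y)" for s y
  define dw where "dw s y = nonlocal_op k (w s) y + Psi k Upsilon (w s) y" for s y
  define C where "C = \<bar>ln \<epsilon>\<bar> + \<bar>ln M\<bar>"
  have pos: "0 < u s y" if "0 < s" for s y
    using \<epsilon> that by (meson less_le_trans)
  have w_bound: "\<bar>w s y\<bar> \<le> C" if s: "0 < s" for s y
  proof -
    have "ln \<epsilon> \<le> w s y" "w s y \<le> ln M"
      using \<epsilon>(1) \<epsilon>(2)[OF s, of y] M[OF s, of y] pos[OF s, of y] by (auto simp: w_def)
    then show ?thesis
      unfolding C_def by linarith
  qed
  note bounds = exp_increment_bounds[of "w _" C, OF w_bound]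
  have w_sum: "(\<lambda>j. k j * (w s (y + j) - w s y)) summable_on UNIV" if "0 < s" for s y
    by (rule jump_kernel_summable_mult[OF k]) (rule bounds(1)[OF that])
  have w_deriv: "((\<lambda>r. w r y) has_real_derivative dw s y) (at s)" if s: "0 < s" for s y
    unfolding w_def[of _ y] dw_def
    by (rule ln_heat_solution_derivative(2)[where u = u and w = w and M = M, OF k pos[OF s] M[OF s] _ w_sum[OF s] u[OF s]])
      (simp add: w_def)
  have dw_bound: "\<bar>dw s y\<bar> \<le> infsum k UNIV * exp (2 * C)" if s: "0 < s" for s y
  proof -
    have e: "(\<lambda>j. k j * (exp (w s (y + j) - w s y) - 1)) summable_on UNIV"
      by (rule jump_kernel_summable_mult[OF k]) (rule bounds(3)[OF s])
    show ?thesis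
      unfolding dw_def nonlocal_op_plus_Psi(2)[OF k w_sum[OF s] e]
      by (intro jump_kernel_infsum_bound k bounds(3)[OF s])
  qed
  define G where "G s y = - nonlocal_op k (w s) y" for s y
  have G_bound: "\<bar>G s y\<bar> \<le> infsum k UNIV * (2 * C)" if s: "0 < s" for s y
    unfolding G_def abs_minus_cancel nonlocal_op_def by (intro jump_kernel_infsum_bound k bounds(1)[OF s])
  have G_deriv: "((\<lambda>r. G r y) has_real_derivative - nonlocal_op k (dw s) y) (at s)" if s: "0 < s" for s y
    unfolding G_def nonlocal_op_def
  proof (intro DERIV_minus has_real_derivative_infsum[where S = "{0<..}" and f' = "\<lambda>j s. k j * (dw s (y + j) - dw s y)"
        and b = "\<lambda>j. k j * (2 * (infsum k UNIV * exp (2 * C)))"])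
    show "\<bar>k j * (dw r (y + j) - dw r y)\<bar> \<le> k j * (2 * (infsum k UNIV * exp (2 * C)))" if "r \<in> {0<..}" for j r
    proof -
      have "\<bar>dw r (y + j) - dw r y\<bar> \<le> 2 * (infsum k UNIV * exp (2 * C))"
        by (rule exp_increment_bounds(1)[of "dw r"]) (use that in \<open>auto intro: dw_bound\<close>)
      then show ?thesis
        using k by (auto simp: abs_mult jump_kernel_def intro: mult_left_mono)
    qed
    show "(\<lambda>j. k j * (2 * (infsum k UNIV * exp (2 * C)))) summable_on UNIV"
      using k by (intro summable_on_cmult_left) (simp add: jump_kernel_def)
  qed (use s w_sum in \<open>auto intro!: derivative_eq_intros w_deriv\<close>)
  \<comment> \<open>\<open>\<phi>\<close> blows up at \<open>0\<close>, so it dominates the bound of \<open>G\<close> at some time before \<open>t\<close>.\<close>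
  have "\<forall>\<^sub>F s in at_right 0. infsum k UNIV * (2 * C) \<le> \<phi> s"
    using \<phi> by (auto simp: relaxation_function_def filterlim_at_top)
  then obtain b where b: "0 < b" "\<And>s. \<lbrakk>0 < s; s < b\<rbrakk> \<Longrightarrow> infsum k UNIV * (2 * C) \<le> \<phi> s"
    by (auto simp: eventually_at_right_field)
  define a where "a = min t b / 2"
  have a: "0 < a" "a \<le> t" "infsum k UNIV * (2 * C) \<le> \<phi> a"
    using b t by (auto simp: a_def)
  have \<phi>_pos: "0 < \<phi> s" and \<phi>_deriv: "(\<phi> has_real_derivative - (2 * F (\<phi> s))) (at s)" if "0 < s" for s
    using \<phi> that by (auto simp: relaxation_function_def)
  have "G t x - \<phi> t \<le> 0"
  proof (rule maximum_principle_bounded_rates[where a = a and C = "infsum k UNIV * (2 * C)"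
        and H = "\<lambda>s y. G s y - \<phi> s" and K = "infsum k UNIV * exp (2 * C)"
        and D = "\<lambda>s y. - nonlocal_op k (dw s) y + 2 * F (\<phi> s)"])
    show "0 \<le> infsum k UNIV * exp (2 * C)"
      using k by (intro mult_nonneg_nonneg infsum_nonneg) (auto simp: jump_kernel_def)
    show "G s y - \<phi> s \<le> infsum k UNIV * (2 * C)" if "a \<le> s" for s y
      using G_bound[of s y] \<phi>_pos[of s] a(1) that by linarith
    show "G a y - \<phi> a \<le> 0" for y
      using G_bound[of a y] a by linarith
    show "((\<lambda>s. G s y - \<phi> s) has_real_derivative - nonlocal_op k (dw s) y + 2 * F (\<phi> s)) (at s)"
      if "a \<le> s" for s y
      using that a(1) by (auto intro!: derivative_eq_intros G_deriv \<phi>_deriv)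
    show "a \<le> t"
      by (fact a(2))
    fix s y m
    assume s: "a \<le> s" and H_pos: "0 < G s y - \<phi> s" and m: "\<And>z. G s z - \<phi> s \<le> m"
    have "0 < s"
      using s a(1) by simp
    define A where "A j = k j * exp (w s (y + j) - w s y)" for j
    note chain = nonlocal_op_chain_rule[of k "w s" C y, OF k w_bound[OF \<open>0 < s\<close>]]
    have "0 < \<phi> s"
      by (rule \<phi>_pos[OF \<open>0 < s\<close>])
    have "w s \<in> linfty"
      using w_bound[OF \<open>0 < s\<close>] by (auto simp: linfty_def bounded_iff)
    then have "F (G s y) \<le> Psi2_Upsilon k (w s) y"
      using CD H_pos \<open>0 < \<phi> s\<close> unfolding CD_Upsilon_0_def G_def by (smt (verit))
    moreover have "F (\<phi> s) \<le> F (G s y)"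
      using H_pos \<open>0 < \<phi> s\<close> by (intro CD_function_mono[OF F]) auto
    moreover have A_sum: "A summable_on UNIV"
      unfolding A_def using bounds(2)[OF \<open>0 < s\<close>]
      by (intro jump_kernel_summable_mult[OF k, where C = "exp (2 * C)"]) auto
    moreover have "A j \<ge> 0" for j
      using k by (simp add: A_def jump_kernel_def)
    then have "(\<Sum>\<^sub>\<infinity>j. A j * (G s (y + j) - G s y)) \<le> (\<Sum>\<^sub>\<infinity>j. A j * (m - (G s y - \<phi> s)))"
    proof (intro infsum_mono mult_left_mono)
      show "(\<lambda>j. A j * (G s (y + j) - G s y)) summable_on UNIV"
        using summable_on_uminus[THEN iffD2, OF chain(1)] by (simp add: A_def G_def algebra_simps)
      show "(\<lambda>j. A j * (m - (G s y - \<phi> s))) summable_on UNIV"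
        by (intro summable_on_cmult_left A_sum)
      show "G s (y + j) - G s y \<le> m - (G s y - \<phi> s)" for j
        using m[of "y + j"] by simp
    qed
    moreover have "(\<Sum>\<^sub>\<infinity>j. A j * (m - (G s y - \<phi> s))) = infsum A UNIV * (m - (G s y - \<phi> s))"
      by (rule infsum_cmult_left')
    moreover have "infsum A UNIV * (m - (G s y - \<phi> s)) \<le> infsum k UNIV * exp (2 * C) * (m - (G s y - \<phi> s))"
    proof (rule mult_right_mono)
      show "infsum A UNIV \<le> infsum k UNIV * exp (2 * C)"
        unfolding A_def using jump_kernel_infsum_bound[OF k, of "\<lambda>j. exp (w s (y + j) - w s y)" "exp (2 * C)"]
          bounds(2)[OF \<open>0 < s\<close>] by simp
      show "0 \<le> m - (G s y - \<phi> s)"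
        using m[of y] by simp
    qed
    moreover have "- nonlocal_op k (dw s) y =
        (\<Sum>\<^sub>\<infinity>j. A j * (G s (y + j) - G s y)) - 2 * Psi2_Upsilon k (w s) y"
    proof -
      have "(\<Sum>\<^sub>\<infinity>j. A j * (G s (y + j) - G s y)) =
          - (\<Sum>\<^sub>\<infinity>j. A j * (nonlocal_op k (w s) (y + j) - nonlocal_op k (w s) y))"
        unfolding infsum_uminus[symmetric] by (simp add: G_def algebra_simps)
      moreover have "dw s = (\<lambda>y. nonlocal_op k (w s) y + Psi k Upsilon (w s) y)"
        by (auto simp: dw_def)
      ultimately show ?thesis
        using chain(2) by (simp add: A_def)
    qed
    ultimately show "- nonlocal_op k (dw s) y + 2 * F (\<phi> s) \<le> infsum k UNIV * exp (2 * C) * (m - (G s y - \<phi> s))"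
      by linarith
  qed
  moreover have "w t = (\<lambda>y. ln (u t y))"
    by (auto simp: w_def)
  ultimately show ?thesis
    by (simp add: G_def)
qed

section \<open>Removing the lower bound\<close>

text \<open>Only the finite partial sums of \<open>k j * (ln M - ln (u (x + j)))\<close> are passed to the limit
  \<open>\<epsilon> \<rightarrow> 0\<close>; all terms are nonnegative, so their common bound yields summability and the bound for
  the infinite sum at once.\<close>

lemma nonlocal_op_ln_shift_limit:
  fixes u :: "int \<Rightarrow> real"
  assumes k: "jump_kernel k"
    and pos: "\<And>y. 0 < u y" and le: "\<And>y. u y \<le> M"
    and bound: "\<And>\<epsilon>. 0 < \<epsilon> \<Longrightarrow> - nonlocal_op k (\<lambda>y. ln (u y + \<epsilon>)) x \<le> c"
  shows "(\<lambda>j. k j * \<bar>ln (u (x + j))\<bar>) summable_on UNIV"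
    and "(\<lambda>j. k j * (ln (u (x + j)) - ln (u x))) summable_on UNIV"
    and "- nonlocal_op k (\<lambda>y. ln (u y)) x \<le> c"
proof -
  have M: "0 < M"
    using pos le by (meson less_le_trans)
  have k_nonneg: "0 \<le> k j" for j
    using k by (simp add: jump_kernel_def)
  have k_sum: "k summable_on UNIV"
    using k by (simp add: jump_kernel_def)
  have partial: "(\<Sum>j\<in>A. k j * (ln M - ln (u (x + j)))) \<le> c + infsum k UNIV * (ln M - ln (u x))"
    if A: "finite A" for A
  proof (rule tendsto_le[where F = "at_right 0"])
    show "((\<lambda>\<epsilon>. \<Sum>j\<in>A. k j * (ln (M + \<epsilon>) - ln (u (x + j) + \<epsilon>))) \<longlongrightarrow>
        (\<Sum>j\<in>A. k j * (ln M - ln (u (x + j))))) (at_right 0)"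
      using pos M by (auto intro!: tendsto_eq_intros simp: less_imp_neq[symmetric])
    show "((\<lambda>\<epsilon>. c + infsum k UNIV * (ln (M + \<epsilon>) - ln (u x + \<epsilon>))) \<longlongrightarrow>
        c + infsum k UNIV * (ln M - ln (u x))) (at_right 0)"
      using pos M by (auto intro!: tendsto_eq_intros simp: less_imp_neq[symmetric])
    show "\<forall>\<^sub>F \<epsilon> in at_right 0. (\<Sum>j\<in>A. k j * (ln (M + \<epsilon>) - ln (u (x + j) + \<epsilon>)))
        \<le> c + infsum k UNIV * (ln (M + \<epsilon>) - ln (u x + \<epsilon>))"
      using eventually_at_right_less
    proof eventually_elim
      fix \<epsilon> :: real
      assume \<epsilon>: "0 < \<epsilon>"
      define w where "w y = ln (u y + \<epsilon>)" for y
      have w: "ln \<epsilon> \<le> w y" "w y \<le> ln (M + \<epsilon>)" for y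
        using pos[of y] le[of y] \<epsilon> M by (auto simp: w_def)
      have "\<bar>w (x + j) - w x\<bar> \<le> ln (M + \<epsilon>) - ln \<epsilon>" for j
        using w[of x] w[of "x + j"] by linarith
      then have w_sum: "(\<lambda>j. k j * (w (x + j) - w x)) summable_on UNIV"
        by (rule jump_kernel_summable_mult[OF k])
      have const_sum: "(\<lambda>j. k j * (ln (M + \<epsilon>) - w x)) summable_on UNIV"
        by (intro summable_on_cmult_left k_sum)
      have eq: "(\<lambda>j. k j * (ln (M + \<epsilon>) - w (x + j))) =
          (\<lambda>j. k j * (ln (M + \<epsilon>) - w x) - k j * (w (x + j) - w x))"
        by (auto simp: algebra_simps)
      have "(\<Sum>j\<in>A. k j * (ln (M + \<epsilon>) - w (x + j))) \<le> (\<Sum>\<^sub>\<infinity>j. k j * (ln (M + \<epsilon>) - w (x + j)))"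
      proof (rule finite_sum_le_infsum[OF _ A])
        show "(\<lambda>j. k j * (ln (M + \<epsilon>) - w (x + j))) summable_on UNIV"
          unfolding eq by (intro summable_on_diff const_sum w_sum)
      qed (use w k_nonneg in auto)
      also have "\<dots> = infsum k UNIV * (ln (M + \<epsilon>) - w x) - nonlocal_op k w x"
        unfolding eq infsum_diff[OF const_sum w_sum] by (simp add: infsum_cmult_left' nonlocal_op_def)
      also have "\<dots> \<le> c + infsum k UNIV * (ln (M + \<epsilon>) - w x)"
        using bound[OF \<epsilon>] by (simp add: w_def[abs_def])
      finally show "(\<Sum>j\<in>A. k j * (ln (M + \<epsilon>) - ln (u (x + j) + \<epsilon>)))
          \<le> c + infsum k UNIV * (ln (M + \<epsilon>) - ln (u x + \<epsilon>))"
        by (simp add: w_def)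
    qed
  qed simp
  have nonneg: "0 \<le> k j * (ln M - ln (u (x + j)))" for j
    using k_nonneg[of j] pos[of "x + j"] le[of "x + j"] M by simp
  have gap_sum: "(\<lambda>j. k j * (ln M - ln (u (x + j)))) summable_on UNIV"
    by (rule nonneg_bounded_partial_sums_imp_summable_on[OF nonneg])
      (use partial in \<open>auto intro: eventually_finite_subsets_at_top_weakI\<close>)
  show "(\<lambda>j. k j * \<bar>ln (u (x + j))\<bar>) summable_on UNIV"
  proof (rule summable_on_comparison_test)
    show "(\<lambda>j. k j * \<bar>ln M\<bar> + k j * (ln M - ln (u (x + j)))) summable_on UNIV"
      by (intro summable_on_add summable_on_cmult_left k_sum gap_sum)
    show "k j * \<bar>ln (u (x + j))\<bar> \<le> k j * \<bar>ln M\<bar> + k j * (ln M - ln (u (x + j)))" for j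
    proof -
      have "ln (u (x + j)) \<le> ln M"
        using pos le M by simp
      then have "\<bar>ln (u (x + j))\<bar> \<le> \<bar>ln M\<bar> + (ln M - ln (u (x + j)))"
        by linarith
      then show ?thesis
        using k_nonneg[of j] by (metis distrib_left mult_left_mono)
    qed
  qed (use k_nonneg in auto)
  have const_sum: "(\<lambda>j. k j * (ln M - ln (u x))) summable_on UNIV"
    by (intro summable_on_cmult_left k_sum)
  have eq: "(\<lambda>j. k j * (ln (u (x + j)) - ln (u x))) =
      (\<lambda>j. k j * (ln M - ln (u x)) - k j * (ln M - ln (u (x + j))))"
    by (auto simp: algebra_simps)
  show "(\<lambda>j. k j * (ln (u (x + j)) - ln (u x))) summable_on UNIV"
    unfolding eq by (intro summable_on_diff const_sum gap_sum)
  have "nonlocal_op k (\<lambda>y. ln (u y)) x =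
      infsum k UNIV * (ln M - ln (u x)) - (\<Sum>\<^sub>\<infinity>j. k j * (ln M - ln (u (x + j))))"
    unfolding nonlocal_op_def eq infsum_diff[OF const_sum gap_sum] by (simp add: infsum_cmult_left')
  moreover have "(\<Sum>\<^sub>\<infinity>j. k j * (ln M - ln (u (x + j)))) \<le> c + infsum k UNIV * (ln M - ln (u x))"
    by (rule infsum_le_finite_sums[OF gap_sum]) (use partial in auto)
  ultimately show "- nonlocal_op k (\<lambda>y. ln (u y)) x \<le> c"
    by linarith
qed

theorem theorem5p2:
  fixes \<alpha> :: real and k :: "int \<Rightarrow> real" and F g \<phi> :: "real \<Rightarrow> real"
    and u v :: "real \<Rightarrow> int \<Rightarrow> real"
  assumes "\<alpha> > 0"
    and "jump_kernel k"
    and "(\<lambda>j. k j * \<bar>real_of_int j\<bar> powr \<alpha>) summable_on UNIV"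
    and "CD_function F"
    and "CD_Upsilon_0 k F"
    and "g 0 = 0"
    and "\<And>x. x > 0 \<Longrightarrow> g x = F x / x"
    and "\<And>x y. x \<ge> 0 \<Longrightarrow> y \<ge> 0 \<Longrightarrow> g x + g y \<le> g (x + y)"
    and "relaxation_function (\<lambda>r. 2 * F r) \<phi>"
    and "\<And>t x. t \<ge> 0 \<Longrightarrow> u t x > 0"
    and "bounded {u t x | t x. t \<ge> 0}"
    and "\<And>x. C1_halfline (\<lambda>t. u t x)"
    and "\<And>t x. t > 0 \<Longrightarrow> deriv (\<lambda>s. u s x) t - nonlocal_op k (u t) x = 0"
    and "\<And>t x. t \<ge> 0 \<Longrightarrow> v t x = ln (u t x)"
  shows "(\<forall>t>0. \<forall>x. (\<lambda>j. v t (x + j)) \<in> l1k k) \<and>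
    (\<forall>t>0. \<forall>x. - nonlocal_op k (v t) x \<le> \<phi> t) \<and>
    (\<forall>t>0. \<forall>x. (\<lambda>s. v s x) differentiable at t \<and>
       (\<lambda>y. k (x - y) * Upsilon (v t y - v t x)) summable_on UNIV \<and>
       deriv (\<lambda>s. v s x) t \<ge> Psi k Upsilon (v t) x - \<phi> t)"
proof -
  note k = assms(2) and F = assms(4) and CD = assms(5) and relax = assms(9)
  have pos: "0 < u t x" if "0 < t" for t x
    using assms(10)[of t x] that by simp
  obtain M where M: "\<And>t x. 0 \<le> t \<Longrightarrow> u t x \<le> M"
    using assms(11) unfolding bounded_iff by (fastforce simp: abs_le_iff)
  have le: "u t x \<le> M" if "0 < t" for t x
    using M[of t x] that by simp
  have u_deriv: "((\<lambda>s. u s x) has_real_derivative nonlocal_op k (u t) x) (at t)" if t: "0 < t" for t x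
  proof -
    have "\<exists>f'. ((\<lambda>s. u s x) has_real_derivative f' t) (at t within {0..})"
      using assms(12)[of x] t unfolding C1_halfline_def by (meson less_imp_le)
    then obtain f' where "((\<lambda>s. u s x) has_real_derivative f' t) (at t within {0..})"
      by blast
    then have "((\<lambda>s. u s x) has_real_derivative f' t) (at t within {0<..})"
      by (rule has_field_derivative_subset) auto
    then have "((\<lambda>s. u s x) has_real_derivative f' t) (at t)"
      using t by (simp add: at_within_open[of t "{0<..}"])
    then show ?thesis
      using assms(13)[OF t, of x] DERIV_imp_deriv by fastforce
  qed
  have v_eq: "v t = (\<lambda>y. ln (u t y))" if "0 < t" for t
    using assms(14) that by auto
  \<comment> \<open>Adding a positive constant to \<open>u\<close> gives a solution bounded away from zero.\<close>
  have shifted: "- nonlocal_op k (\<lambda>y. ln (u t y + \<epsilon>)) x \<le> \<phi> t" if "0 < t" "0 < \<epsilon>" for t x \<epsilon>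
  proof (rule neg_nonlocal_op_ln_le_relaxation[OF k F CD relax \<open>0 < \<epsilon>\<close> _ _ _ \<open>0 < t\<close>])
    show "\<epsilon> \<le> u s y + \<epsilon>" "u s y + \<epsilon> \<le> M + \<epsilon>" if "0 < s" for s y
      using pos[OF that, of y] le[OF that, of y] by auto
    show "((\<lambda>r. u r y + \<epsilon>) has_real_derivative nonlocal_op k (\<lambda>y. u s y + \<epsilon>) y) (at s)" if "0 < s" for s y
      using u_deriv[OF that, of y] by (auto intro!: derivative_eq_intros simp: nonlocal_op_def)
  qed
  note limit = nonlocal_op_ln_shift_limit[of k "u t" M x "\<phi> t" for t x, OF k pos le shifted]
  have l1: "(\<lambda>j. v t (x + j)) \<in> l1k k" if t: "0 < t" for t x
    using limit(1)[OF t t t, of x] by (simp add: l1k_def v_eq[OF t])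
  have Lv: "- nonlocal_op k (v t) x \<le> \<phi> t" if t: "0 < t" for t x
    using limit(3)[OF t t t, of x] by (simp add: v_eq[OF t])
  have v_sum: "(\<lambda>j. k j * Upsilon (v t (x + j) - v t x)) summable_on UNIV"
    and v_deriv: "((\<lambda>s. v s x) has_real_derivative nonlocal_op k (v t) x + Psi k Upsilon (v t) x) (at t)"
    if t: "0 < t" for t x
  proof -
    have "(\<lambda>j. k j * (v t (x + j) - v t x)) summable_on UNIV"
      using limit(2)[OF t t t, of x] by (simp add: v_eq[OF t])
    note ln_deriv = ln_heat_solution_derivative[of k u t M v, OF k pos[OF t] le[OF t] _ this u_deriv[OF t]]
    show "(\<lambda>j. k j * Upsilon (v t (x + j) - v t x)) summable_on UNIV"
      by (rule ln_deriv(1)) (simp add: v_eq[OF t])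
    have "((\<lambda>s. ln (u s x)) has_real_derivative nonlocal_op k (v t) x + Psi k Upsilon (v t) x) (at t)"
      by (rule ln_deriv(2)) (simp add: v_eq[OF t])
    then show "((\<lambda>s. v s x) has_real_derivative nonlocal_op k (v t) x + Psi k Upsilon (v t) x) (at t)"
      by (rule DERIV_cong_ev[THEN iffD1, rotated -1, OF _ refl])
        (use t v_eq in \<open>auto intro!: eventually_mono[OF eventually_nhds_in_open[of "{0<..}"]]\<close>)
  qed
  have "Psi k Upsilon (v t) x - \<phi> t \<le> deriv (\<lambda>s. v s x) t" if t: "0 < t" for t x
    using DERIV_imp_deriv[OF v_deriv[OF t, of x]] Lv[OF t, of x] by simp
  moreover have "(\<lambda>s. v s x) differentiable at t" if t: "0 < t" for t x
    using v_deriv[OF t] real_differentiable_def by blast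
  moreover have "(\<lambda>y. k (x - y) * Upsilon (v t y - v t x)) summable_on UNIV" if t: "0 < t" for t x
    using v_sum[OF t] by (simp add: Psi_summable_increments[OF k])
  ultimately show ?thesis
    using l1 Lv by simp
qed

end
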